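(* For every integer $i\geq 1$ there exists a tanglegram $\mathcal{T}$ of size $2^i$ whose tanglegram crossing number is exactly $$\operatorname{crt}(\mathcal{T})=\frac{1}{2}\binom{2^i}{2}-i\,2^{i-2}.$$
   Context: A rooted binary tree is a rooted tree in which every vertex has either two children or none (vertices with no children are leaves; a single vertex is allowed). A tanglegram $\mathcal{T}=(L,R,\sigma)$ consists of two rooted binary trees $L,R$ with the same number $n$ of leaves and a perfect matching $\sigma$ between the leaf set of $L$ and the leaf set of $R$; $n$ is the size of $\mathcal{T}$. A layout of $\mathcal{T}$ is obtained by choosing, at every internal vertex of $L$ and of $R$, a left/right order of its two children; this determines a top-to-bottom linear order of the leaves of $L$ (drawn on the line $x=0$, with $L$ drawn as a plane tree in $x\le 0$) and of the leaves of $R$ (on the line $x=1$, with $R$ drawn as a plane tree in $x\ge 1$), and the matching edges are straight segments between the two lines. Two matching edges cross in the layout iff their endpoints appear in opposite relative orders on the two lines. The crossing number of a layout is the number of crossing pairs of matching edges, and the tanglegram crossing number $\operatorname{crt}(\mathcal{T})$ is the minimum crossing number over all layouts of $\mathcal{T}$. *)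

theory Defs
  imports Complex_Main
begin

text \<open>
  A rooted binary tree whose leaves carry names. A value of this type also records an order
  of the two children of each internal vertex; as a rooted tree it is considered only up to
  these orders, and as a plane tree it is the drawing given by them.
\<close>

datatype 'a btree = Leaf 'a | Node "'a btree" "'a btree"

fun leaf_list :: "'a btree \<Rightarrow> 'a list" where
  "leaf_list (Leaf a) = [a]"
| "leaf_list (Node l r) = leaf_list l @ leaf_list r"

definition leaves :: "'a btree \<Rightarrow> 'a set" where
  "leaves t = set (leaf_list t)"

fun orderings :: "'a btree \<Rightarrow> 'a btree set" where
  "orderings (Leaf a) = {Leaf a}"
| "orderings (Node l r) =
     {Node l' r' | l' r'. l' \<in> orderings l \<and> r' \<in> orderings r} \<union>
     {Node r' l' | l' r'. l' \<in> orderings l \<and> r' \<in> orderings r}"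

definition perfect_matching :: "'a set \<Rightarrow> 'b set \<Rightarrow> ('a \<times> 'b) set \<Rightarrow> bool" where
  "perfect_matching A B M \<longleftrightarrow>
     M \<subseteq> A \<times> B \<and> (\<forall>a\<in>A. \<exists>!b. (a, b) \<in> M) \<and> (\<forall>b\<in>B. \<exists>!a. (a, b) \<in> M)"

type_synonym ('a, 'b) tangle = "'a btree \<times> 'b btree \<times> ('a \<times> 'b) set"

text \<open>Distinctness of the names ensures that they identify the leaf vertices.\<close>

fun tanglegram :: "('a, 'b) tangle \<Rightarrow> bool" where
  "tanglegram (L, R, M) \<longleftrightarrow>
     distinct (leaf_list L) \<and> distinct (leaf_list R) \<and>
     card (leaves L) = card (leaves R) \<and>
     perfect_matching (leaves L) (leaves R) M"

fun tanglegram_size :: "('a, 'b) tangle \<Rightarrow> nat" where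
  "tanglegram_size (L, R, M) = card (leaves L)"

fun layouts :: "('a, 'b) tangle \<Rightarrow> ('a btree \<times> 'b btree) set" where
  "layouts (L, R, M) = orderings L \<times> orderings R"

definition above :: "'a btree \<Rightarrow> 'a \<Rightarrow> 'a \<Rightarrow> bool" where
  "above t a b \<longleftrightarrow>
     (\<exists>i j. i < j \<and> j < length (leaf_list t) \<and> leaf_list t ! i = a \<and> leaf_list t ! j = b)"

fun cross :: "'a btree \<times> 'b btree \<Rightarrow> 'a \<times> 'b \<Rightarrow> 'a \<times> 'b \<Rightarrow> bool" where
  "cross (l, r) (a, b) (a', b') \<longleftrightarrow>
     above l a a' \<and> above r b' b \<or> above l a' a \<and> above r b b'"

definition layout_crossings :: "('a \<times> 'b) set \<Rightarrow> 'a btree \<times> 'b btree \<Rightarrow> nat" where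
  "layout_crossings M d = card {{e, f} | e f. e \<in> M \<and> f \<in> M \<and> cross d e f}"

fun crt :: "('a, 'b) tangle \<Rightarrow> nat" where
  "crt (L, R, M) = Min (layout_crossings M ` layouts (L, R, M))"

lemma finite_orderings: "finite (orderings t)"
proof (induction t)
  case (Node l r)
  have "orderings (Node l r) =
      (\<lambda>(x, y). Node x y) ` (orderings l \<times> orderings r) \<union>
      (\<lambda>(x, y). Node y x) ` (orderings l \<times> orderings r)"
    by auto
  then show ?case using Node by (metis finite_SigmaI finite_UnI finite_imageI)
qed simp

lemma self_in_orderings: "t \<in> orderings t"
  by (induction t) auto

lemma leaves_orderings: "t' \<in> orderings t \<Longrightarrow> leaves t' = leaves t"
  unfolding leaves_def by (induction t arbitrary: t') fastforce+

lemma distinct_orderings: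
  "t' \<in> orderings t \<Longrightarrow> distinct (leaf_list t) \<Longrightarrow> distinct (leaf_list t')"
proof (induction t arbitrary: t')
  case (Node l r)
  then show ?case
    using leaves_orderings[unfolded leaves_def] by (fastforce simp: Int_commute)
qed simp

lemma finite_layouts: "finite (layouts T)"
  by (cases T) (simp add: finite_orderings)

lemma layouts_nonempty: "layouts T \<noteq> {}"
  by (cases T) (auto intro: self_in_orderings)

end

theory Submission
  imports Defs "HOL-Library.Countable"
begin

text \<open>
  Both trees are the complete binary tree on the words of length \<open>i\<close>, and every word is matched
  with its reversal. A pair of words then branches at its first differing position in \<open>L\<close> and at
  its last differing position in \<open>R\<close>. If these positions differ, complementing the last differing
  letter of both words keeps the two branch vertices and the order in \<open>L\<close> but reverses the order
  in \<open>R\<close>; so in every layout exactly half of these pairs cross. The remaining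
  \<open>i 2\<^bsup>i-1\<^esup>\<close> pairs, differing in one letter only, do not cross when all children are
  ordered alphabetically.
\<close>

section \<open>The order of the leaves of a plane tree\<close>

text \<open>The leaf list is a concatenation, so two positions \<open>i < j\<close> lie both before
  the cut, both after it, or on either side of it.\<close>

lemma above_Node:
  "above (Node l r) x y \<longleftrightarrow>
     above l x y \<or> above r x y \<or> x \<in> leaves l \<and> y \<in> leaves r"
  (is "?A \<longleftrightarrow> ?B \<or> ?C \<or> ?D")
proof
  let ?m = "length (leaf_list l)"
  assume ?A
  then obtain i j where ij: "i < j" "j < ?m + length (leaf_list r)"
    "(leaf_list l @ leaf_list r) ! i = x" "(leaf_list l @ leaf_list r) ! j = y"
    unfolding above_def by auto
  consider "j < ?m" | "i < ?m" "?m \<le> j" | "?m \<le> i" by linarith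
  then show "?B \<or> ?C \<or> ?D"
  proof cases
    case 1
    then have ?B using ij unfolding above_def by (auto simp: nth_append)
    then show ?thesis ..
  next
    case 2
    then have ?D using ij unfolding leaves_def by (auto simp: nth_append)
    then show ?thesis by simp
  next
    case 3
    then have "i - ?m < j - ?m" "j - ?m < length (leaf_list r)"
      "leaf_list r ! (i - ?m) = x" "leaf_list r ! (j - ?m) = y"
      using ij by (auto simp: nth_append)
    then have ?C unfolding above_def by blast
    then show ?thesis by simp
  qed
next
  let ?m = "length (leaf_list l)"
  assume "?B \<or> ?C \<or> ?D"
  then show ?A
  proof (elim disjE)
    assume ?B
    then obtain i j where "i < j" "j < ?m" "leaf_list l ! i = x" "leaf_list l ! j = y"
      unfolding above_def by auto
    then show ?A unfolding above_def
      by (intro exI[of _ i] exI[of _ j]) (auto simp: nth_append)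
  next
    assume ?C
    then obtain i j where "i < j" "j < length (leaf_list r)"
      "leaf_list r ! i = x" "leaf_list r ! j = y"
      unfolding above_def by auto
    then show ?A unfolding above_def
      by (intro exI[of _ "?m + i"] exI[of _ "?m + j"]) (auto simp: nth_append)
  next
    assume ?D
    then obtain i j where "i < ?m" "j < length (leaf_list r)"
      "leaf_list l ! i = x" "leaf_list r ! j = y"
      unfolding leaves_def in_set_conv_nth by auto
    then show ?A unfolding above_def
      by (intro exI[of _ i] exI[of _ "?m + j"]) (auto simp: nth_append)
  qed
qed

lemma above_imp_leaves: "above t x y \<Longrightarrow> x \<in> leaves t \<and> y \<in> leaves t"
  unfolding above_def leaves_def by (metis less_trans nth_mem)

lemma above_asym: "distinct (leaf_list t) \<Longrightarrow> above t x y \<Longrightarrow> \<not> above t y x"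
  unfolding above_def by (metis (no_types) less_asym less_trans nth_eq_iff_index_eq)

lemma above_total:
  assumes "x \<in> leaves t" "y \<in> leaves t" "x \<noteq> y"
  shows "above t x y \<or> above t y x"
  using assms unfolding leaves_def above_def in_set_conv_nth by (metis linorder_neqE_nat)

section \<open>The complete binary tree on words\<close>

text \<open>The naming function \<open>f\<close> is a parameter so that each child is again a
  \<open>word_tree\<close>, with the first letter absorbed into the names. It also allows the leaves
  to be renamed by numbers at the end.\<close>

fun word_tree :: "nat \<Rightarrow> (bool list \<Rightarrow> 'a) \<Rightarrow> 'a btree" where
  "word_tree 0 f = Leaf (f [])"
| "word_tree (Suc k) f =
     Node (word_tree k (\<lambda>w. f (False # w))) (word_tree k (\<lambda>w. f (True # w)))"

lemma inj_Cons_comp: "inj f \<Longrightarrow> inj (\<lambda>w. f (c # w))"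
  by (auto intro!: injI dest: injD)

lemma leaves_Node: "leaves (Node l r) = leaves l \<union> leaves r"
  by (simp add: leaves_def)

lemma leaves_word_tree: "leaves (word_tree k f) = f ` {w. length w = k}"
proof (induction k arbitrary: f)
  case 0
  then show ?case by (simp add: leaves_def)
next
  case (Suc k)
  have "{w. length w = Suc k} = (#) False ` {w. length w = k} \<union> (#) True ` {w. length w = k}"
    by (auto simp: length_Suc_conv image_iff)
  then show ?case by (simp add: leaves_Node Suc image_Un image_image)
qed

lemma distinct_word_tree: "inj f \<Longrightarrow> distinct (leaf_list (word_tree k f))"
proof (induction k arbitrary: f)
  case (Suc k)
  have "leaves (word_tree k (\<lambda>w. f (False # w))) \<inter> leaves (word_tree k (\<lambda>w. f (True # w))) = {}"
    using Suc.prems by (auto simp: leaves_word_tree inj_def)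
  then show ?case using Suc by (simp add: leaves_def inj_Cons_comp)
qed simp

text \<open>The two leaves part at the vertex \<open>u\<close>, so their order depends only on how
  the children of that vertex are arranged, not on the suffixes. The assumptions are symmetric in
  the old and new suffixes, so the implication can also be used backwards.\<close>

lemma above_orderings_word_tree:
  assumes "inj f" "t \<in> orderings (word_tree k f)"
    "length u + length a + 1 = k" "length b = length a"
    "length a' = length a" "length b' = length a"
    "above t (f (u @ c # a)) (f (u @ (\<not> c) # b))"
  shows "above t (f (u @ c # a')) (f (u @ (\<not> c) # b'))"
  using assms
proof (induction u arbitrary: k f t)
  case Nil
  define l r where lr: "l = word_tree (k - 1) (\<lambda>w. f (False # w))"
    "r = word_tree (k - 1) (\<lambda>w. f (True # w))"
  have k: "k = Suc (length a)" using Nil by simp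
  obtain l' r' where t: "t = Node l' r' \<or> t = Node r' l'" "l' \<in> orderings l" "r' \<in> orderings r"
    using Nil.prems(2) by (auto simp: k lr)
  have "leaves l' = (\<lambda>w. f (False # w)) ` {w. length w = length a}"
    "leaves r' = (\<lambda>w. f (True # w)) ` {w. length w = length a}"
    using leaves_orderings[OF t(2)] leaves_orderings[OF t(3)] by (simp_all add: lr leaves_word_tree k)
  then have mem: "f (e # w) \<in> leaves l' \<longleftrightarrow> \<not> e \<and> length w = length a"
    "f (e # w) \<in> leaves r' \<longleftrightarrow> e \<and> length w = length a" for e w
    using Nil.prems(1) by (auto simp: inj_eq)
  \<comment> \<open>Words with different first letters never lie in the same child, so only the last
    case of \<open>above_Node\<close> remains, and it ignores the suffixes.\<close>
  have "\<not> above l' (f (c # w)) (f ((\<not> c) # w'))" "\<not> above r' (f (c # w)) (f ((\<not> c) # w'))" for w w'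
    using above_imp_leaves[of l' "f (c # w)" "f ((\<not> c) # w')"]
      above_imp_leaves[of r' "f (c # w)" "f ((\<not> c) # w')"] by (auto simp: mem)
  then show ?case using t(1) Nil.prems(4-) by (auto simp: above_Node mem)
next
  case (Cons e u)
  obtain m where k: "k = Suc m" using Cons.prems by (cases k) auto
  obtain l' r' where t: "t = Node l' r' \<or> t = Node r' l'"
    "l' \<in> orderings (word_tree m (\<lambda>w. f (False # w)))"
    "r' \<in> orderings (word_tree m (\<lambda>w. f (True # w)))"
    using Cons.prems(2) by (auto simp: k)
  have "leaves l' = (\<lambda>w. f (False # w)) ` {w. length w = m}"
    "leaves r' = (\<lambda>w. f (True # w)) ` {w. length w = m}"
    using leaves_orderings[OF t(2)] leaves_orderings[OF t(3)] by (simp_all add: leaves_word_tree)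
  then have mem: "f (d # w) \<in> leaves l' \<longleftrightarrow> \<not> d \<and> length w = m"
    "f (d # w) \<in> leaves r' \<longleftrightarrow> d \<and> length w = m" for d w
    using Cons.prems(1) by (auto simp: inj_eq)
  \<comment> \<open>\<open>s\<close> is the child containing all words that begin with
    \<open>e\<close>, on whichever side it is drawn.\<close>
  define s where "s = (if e then r' else l')"
  have s: "s \<in> orderings (word_tree m (\<lambda>w. f (e # w)))"
    using t by (cases e) (auto simp: s_def)
  have above_s: "above t (f (e # w)) (f (e # w')) \<longleftrightarrow> above s (f (e # w)) (f (e # w'))" for w w'
    using t(1) above_imp_leaves[of l' "f (e # w)" "f (e # w')"]
      above_imp_leaves[of r' "f (e # w)" "f (e # w')"]
    by (cases e) (auto simp: above_Node mem s_def)
  show ?case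
    using Cons.IH[OF inj_Cons_comp[OF Cons.prems(1)] s] Cons.prems(3-) by (simp add: above_s k)
qed

text \<open>The \<open>False\<close> child comes first at every vertex, so the undisturbed tree
  lists the words alphabetically. This is the layout that will attain the minimum.\<close>

lemma above_word_tree:
  assumes "length u + length a + 1 = k" "length b = length a"
  shows "above (word_tree k f) (f (u @ False # a)) (f (u @ True # b))"
  using assms
proof (induction u arbitrary: k f)
  case Nil
  then have "k = Suc (length a)" by simp
  then show ?case using Nil by (auto simp: above_Node leaves_word_tree)
next
  case (Cons e u)
  then obtain m where k: "k = Suc m" by (cases k) auto
  show ?case using Cons.IH[of m "\<lambda>w. f (e # w)"] Cons.prems
    by (cases e) (auto simp: above_Node k)
qed

section \<open>Pairs of words\<close>

text \<open>The letters after \<open>u\<close> are complementary, so \<open>u\<close> must be the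
  longest common prefix of the two words, and this fixes everything else.\<close>

lemma first_difference_unique:
  assumes "u @ c # a = u' @ c' # a'" "u @ (\<not> c) # b = u' @ (\<not> c') # b'"
  shows "u = u' \<and> c = c' \<and> a = a' \<and> b = b'"
  using assms
proof (induction u arbitrary: u')
  case Nil
  then show ?case by (cases u') auto
next
  case (Cons e u)
  then show ?case by (cases u') auto
qed

lemma last_difference_unique:
  assumes "a @ c # v = a' @ c' # v'" "b @ (\<not> c) # v = b' @ (\<not> c') # v'"
  shows "a = a' \<and> b = b' \<and> c = c' \<and> v = v'"
proof -
  have "rev v @ c # rev a = rev v' @ c' # rev a'" "rev v @ (\<not> c) # rev b = rev v' @ (\<not> c') # rev b'"
    using assms[THEN arg_cong[where f = rev]] by simp_all
  from first_difference_unique[OF this] show ?thesis by simp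
qed

section \<open>Pairs differing in one letter and pairs differing in several letters\<close>

definition word_pairs :: "nat \<Rightarrow> (bool list \<times> bool list) set" where
  "word_pairs k = {(u @ False # a, u @ True # b) | u a b.
     length u + length a + 1 = k \<and> length b = length a}"

definition single_pairs :: "nat \<Rightarrow> (bool list \<times> bool list) set" where
  "single_pairs k = {(u @ False # a, u @ True # a) | u a. length u + length a + 1 = k}"

text \<open>A frame is a pair of words with the letters at the last differing position left blank:
  \<open>u\<close> is the common prefix, \<open>v\<close> the common suffix, and \<open>a\<close>,
  \<open>b\<close> are the free parts in between. The summand 2 counts the first and the last
  differing position; \<open>frame_pair c\<close> fills the blank.\<close>

definition frames :: "nat \<Rightarrow> (bool list \<times> bool list \<times> bool list \<times> bool list) set" where
  "frames k = {(u, a, b, v). length u + length a + length v + 2 = k \<and> length b = length a}"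

fun frame_pair :: "bool \<Rightarrow> bool list \<times> bool list \<times> bool list \<times> bool list \<Rightarrow> bool list \<times> bool list"
  where "frame_pair c (u, a, b, v) = (u @ False # a @ c # v, u @ True # b @ (\<not> c) # v)"

lemma finite_words: "finite {w :: bool list. length w = k}"
  using finite_lists_length_eq[of "UNIV :: bool set" k] by simp

lemma card_words: "card {w :: bool list. length w = k} = 2 ^ k"
  using card_lists_length_eq[of "UNIV :: bool set" k] by simp

lemma finite_word_pairs: "finite (word_pairs k)"
  by (rule finite_subset[of _ "{w. length w = k} \<times> {w. length w = k}"])
    (auto simp: word_pairs_def finite_words)

lemma frame_pair_eqD:
  assumes "frame_pair c q = frame_pair c' q'"
  shows "c = c' \<and> q = q'"
proof -
  obtain u a b v u' a' b' v' where q: "q = (u, a, b, v)" "q' = (u', a', b', v')"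
    by (metis prod_cases4)
  \<comment> \<open>The trivial conjunct keeps the shape of \<open>first_difference_unique\<close>,
    with \<open>False\<close> for both letters.\<close>
  have "u = u' \<and> False = False \<and> a @ c # v = a' @ c' # v' \<and> b @ (\<not> c) # v = b' @ (\<not> c') # v'"
    using assms by (intro first_difference_unique) (auto simp: q)
  then show ?thesis using last_difference_unique[of a c v a' c' v' b b'] by (auto simp: q)
qed

lemma inj_frame_pair: "inj_on (frame_pair c) A"
  by (rule inj_onI) (use frame_pair_eqD in blast)

text \<open>After the first difference the remainders either agree, or have a last difference, whose
  letter in the first word tells which filling of the frame occurs.\<close>

lemma word_pairs_split:
  "word_pairs k = single_pairs k \<union> (frame_pair False ` frames k \<union> frame_pair True ` frames k)"
proof (intro equalityI subsetI)
  fix p assume "p \<in> word_pairs k"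
  then obtain u a b where p: "p = (u @ False # a, u @ True # b)"
    "length u + length a + 1 = k" "length b = length a"
    by (auto simp: word_pairs_def)
  show "p \<in> single_pairs k \<union> (frame_pair False ` frames k \<union> frame_pair True ` frames k)"
  proof (cases "a = b")
    case True
    then have "p \<in> single_pairs k" unfolding single_pairs_def using p(1,2) by blast
    then show ?thesis ..
  next
    case False
    \<comment> \<open>The first difference of the reversed remainders is the last difference of the
      remainders.\<close>
    then have "rev a \<noteq> rev b" "length (rev a) = length (rev b)" using p(3) by simp_all
    from same_length_different[OF this] obtain w x y a' b'
      where *: "x \<noteq> y" "rev a = w @ [x] @ a'" "rev b = w @ [y] @ b'" by blast
    then have ab: "a = rev a' @ x # rev w" "b = rev b' @ (\<not> x) # rev w"
      by (simp_all add: rev_swap)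
    define q where "q = (u, rev a', rev b', rev w)"
    have "p = frame_pair x q" "q \<in> frames k"
      using p ab by (auto simp: q_def frames_def)
    then show ?thesis by (cases x) auto
  qed
next
  fix p assume "p \<in> single_pairs k \<union> (frame_pair False ` frames k \<union> frame_pair True ` frames k)"
  then consider "p \<in> single_pairs k" | c q where "q \<in> frames k" "p = frame_pair c q" by blast
  then show "p \<in> word_pairs k"
  proof cases
    case 1
    then show ?thesis unfolding single_pairs_def word_pairs_def by blast
  next
    case 2
    obtain u a b v where q: "q = (u, a, b, v)" by (metis prod_cases4)
    have "p = (u @ False # (a @ c # v), u @ True # (b @ (\<not> c) # v))"
      "length u + length (a @ c # v) + 1 = k" "length (b @ (\<not> c) # v) = length (a @ c # v)"
      using 2 by (auto simp: q frames_def)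
    then show ?thesis unfolding word_pairs_def by blast
  qed
qed

lemma single_pairs_disjoint: "single_pairs k \<inter> frame_pair c ` frames k = {}"
proof -
  have False if "(u @ False # a, u @ True # a) = frame_pair c (u', a', b', v')" for u a u' a' b' v'
  proof -
    have "u = u' \<and> False = False \<and> a = a' @ c # v' \<and> a = b' @ (\<not> c) # v'"
      using that by (intro first_difference_unique) auto
    \<comment> \<open>Cancelling the common suffix \<open>v'\<close> would leave equal words with
      different last letters.\<close>
    then have "a' @ c # v' = b' @ (\<not> c) # v'" by metis
    then show False by simp
  qed
  then show ?thesis unfolding single_pairs_def by (auto simp del: frame_pair.simps)
qed

lemma frame_pair_disjoint: "frame_pair False ` frames k \<inter> frame_pair True ` frames k = {}"
  using frame_pair_eqD by blast

text \<open>Such a pair amounts to the position \<open>n\<close> of the differing letter and the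
  word of length \<open>k - 1\<close> left after deleting it; \<open>h\<close> inserts the letter
  again.\<close>

lemma card_single_pairs: "card (single_pairs k) = k * 2 ^ (k - 1)"
proof -
  define h :: "nat \<times> bool list \<Rightarrow> bool list \<times> bool list"
    where "h = (\<lambda>(n, w). (take n w @ False # drop n w, take n w @ True # drop n w))"
  let ?D = "{..<k} \<times> {w :: bool list. length w = k - 1}"
  have "single_pairs k = h ` ?D"
  proof (intro equalityI subsetI)
    fix p assume "p \<in> single_pairs k"
    then obtain u a where "p = (u @ False # a, u @ True # a)" "length u + length a + 1 = k"
      by (auto simp: single_pairs_def)
    then have "p = h (length u, u @ a)" "(length u, u @ a) \<in> ?D" by (auto simp: h_def)
    then show "p \<in> h ` ?D" by blast
  next
    fix p assume "p \<in> h ` ?D"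
    then show "p \<in> single_pairs k" unfolding single_pairs_def h_def by force
  qed
  moreover have "inj_on h ?D"
  proof (rule inj_onI, clarify)
    fix n w n' w'
    assume *: "n < k" "n' < k" "length w = k - 1" "length w' = k - 1" "h (n, w) = h (n', w')"
    then have "take n w = take n' w' \<and> False = False \<and> drop n w = drop n' w' \<and> drop n w = drop n' w'"
      by (intro first_difference_unique) (auto simp: h_def)
    \<comment> \<open>Both positions are at most \<open>k - 1\<close>, so the prefixes have lengths
      exactly \<open>n\<close> and \<open>n'\<close>.\<close>
    moreover from this have "n = n'"
      using * by (metis length_take min.absorb2 Suc_pred' less_Suc_eq_le gr_implies_not0 not_gr_zero)
    ultimately show "n = n' \<and> w = w'" by (metis append_take_drop_id)
  qed
  ultimately show ?thesis by (simp add: card_image card_cartesian_product card_words)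
qed

text \<open>The word with \<open>False\<close> at the first difference always comes first in
  \<open>word_pairs\<close>, so no pair occurs in both orders.\<close>

lemma inj_on_unordered_word_pairs: "inj_on (\<lambda>(x, y). {x, y}) (word_pairs k)"
proof (rule inj_onI, clarify)
  fix x y x' y' assume *: "(x, y) \<in> word_pairs k" "(x', y') \<in> word_pairs k" "{x, y} = {x', y'}"
  have False if "x = y'" "y = x'"
  proof -
    obtain u a b u' a' b' where "x = u @ False # a" "y = u @ True # b"
      "x' = u' @ False # a'" "y' = u' @ True # b'"
      using * by (auto simp: word_pairs_def)
    then show False using that first_difference_unique[of u False a u' True b' b a'] by auto
  qed
  then show "x = x' \<and> y = y'" using *(3) by (auto simp: doubleton_eq_iff)
qed

lemma word_pairs_total:
  assumes "length x = k" "length y = k" "x \<noteq> y"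
  shows "(x, y) \<in> word_pairs k \<or> (y, x) \<in> word_pairs k"
proof -
  obtain u c a d b where *: "c \<noteq> d" "x = u @ [c] @ a" "y = u @ [d] @ b"
    using same_length_different[of x y] assms by metis
  have len: "length u + length a + 1 = k" "length b = length a" using * assms(1,2) by auto
  show ?thesis
  proof (cases c)
    case True
    then have "x = u @ True # a" "y = u @ False # b" using * by auto
    then have "(y, x) \<in> word_pairs k" unfolding word_pairs_def using len by force
    then show ?thesis ..
  next
    case False
    then have "x = u @ False # a" "y = u @ True # b" using * by auto
    then have "(x, y) \<in> word_pairs k" unfolding word_pairs_def using len by blast
    then show ?thesis ..
  qed
qed

lemma word_pairs_distinct: "(x, y) \<in> word_pairs k \<Longrightarrow> length x = k \<and> length y = k \<and> x \<noteq> y"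
  by (auto simp: word_pairs_def)

lemma doubleton_in_image:
  assumes "(x, y) \<in> A \<or> (y, x) \<in> A"
  shows "{x, y} \<in> (\<lambda>(x, y). {x, y}) ` A"
  using assms
proof
  assume "(x, y) \<in> A"
  then show ?thesis by (rule rev_image_eqI) simp
next
  assume "(y, x) \<in> A"
  then show ?thesis by (rule rev_image_eqI) auto
qed

text \<open>Forgetting the order turns \<open>word_pairs k\<close> bijectively into the two-element
  sets of words of length \<open>k\<close>.\<close>

lemma card_word_pairs: "card (word_pairs k) = 2 ^ k choose 2"
proof -
  let ?W = "{w :: bool list. length w = k}"
  have "(\<lambda>(x, y). {x, y}) ` word_pairs k = {B. B \<subseteq> ?W \<and> card B = 2}"
  proof (intro equalityI subsetI)
    fix B assume "B \<in> (\<lambda>(x, y). {x, y}) ` word_pairs k"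
    then show "B \<in> {B. B \<subseteq> ?W \<and> card B = 2}" by (auto dest: word_pairs_distinct)
  next
    fix B assume "B \<in> {B. B \<subseteq> ?W \<and> card B = 2}"
    then obtain x y where B: "B = {x, y}" "x \<noteq> y" "length x = k" "length y = k"
      by (auto simp: card_2_iff)
    then show "B \<in> (\<lambda>(x, y). {x, y}) ` word_pairs k"
      using doubleton_in_image[OF word_pairs_total] by blast
  qed
  then have "card (word_pairs k) = card {B. B \<subseteq> ?W \<and> card B = 2}"
    using card_image[OF inj_on_unordered_word_pairs, of k] by simp
  then show ?thesis by (simp add: n_subsets finite_words card_words)
qed

lemma finite_frames: "finite (frames k)"
proof (rule finite_imageD[OF _ inj_frame_pair])
  show "finite (frame_pair False ` frames k)"
    using finite_word_pairs[of k] by (simp add: word_pairs_split)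
qed

text \<open>Frames are not counted directly: their number follows from this identity and the other
  two cardinalities. The factor 2 comes from the two fillings of a frame.\<close>

lemma card_word_pairs_split: "card (word_pairs k) = card (single_pairs k) + 2 * card (frames k)"
proof -
  have "finite (single_pairs k)" using finite_word_pairs[of k] by (simp add: word_pairs_split)
  then show ?thesis unfolding word_pairs_split
    by (simp add: card_Un_disjoint finite_frames single_pairs_disjoint frame_pair_disjoint
        Int_Un_distrib card_image inj_frame_pair)
qed

section \<open>The bit reversal tanglegram\<close>

definition reversal_edge :: "(bool list \<Rightarrow> 'a) \<Rightarrow> bool list \<Rightarrow> 'a \<times> 'a" where
  "reversal_edge f w = (f w, f (rev w))"

definition reversal_matching :: "nat \<Rightarrow> (bool list \<Rightarrow> 'a) \<Rightarrow> ('a \<times> 'a) set" where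
  "reversal_matching k f = reversal_edge f ` {w. length w = k}"

definition reversal_tanglegram :: "nat \<Rightarrow> (bool list \<Rightarrow> 'a) \<Rightarrow> ('a, 'a) tangle" where
  "reversal_tanglegram k f = (word_tree k f, word_tree k f, reversal_matching k f)"

text \<open>Reversal is an involution, so the partner of \<open>f x\<close> is
  \<open>f (rev x)\<close> in both directions.\<close>

lemma tanglegram_reversal: "inj f \<Longrightarrow> tanglegram (reversal_tanglegram k f)"
proof -
  assume inj: "inj f"
  have mem: "(f x, f y) \<in> reversal_matching k f \<longleftrightarrow> length x = k \<and> y = rev x" for x y
    using inj by (auto simp: reversal_matching_def reversal_edge_def inj_eq)
  have sub: "reversal_matching k f \<subseteq> f ` {w. length w = k} \<times> f ` {w. length w = k}"
    by (auto simp: reversal_matching_def reversal_edge_def)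
  have "\<exists>!b. (f x, b) \<in> reversal_matching k f" if "length x = k" for x
  proof (rule ex1I[of _ "f (rev x)"])
    show "(f x, f (rev x)) \<in> reversal_matching k f" using that by (simp add: mem)
    show "b = f (rev x)" if e: "(f x, b) \<in> reversal_matching k f" for b
    proof -
      obtain w where "b = f w" using e sub by blast
      then show ?thesis using e by (simp add: mem)
    qed
  qed
  moreover have "\<exists>!a. (a, f x) \<in> reversal_matching k f" if "length x = k" for x
  proof (rule ex1I[of _ "f (rev x)"])
    show "(f (rev x), f x) \<in> reversal_matching k f" using that by (simp add: mem)
    show "a = f (rev x)" if e: "(a, f x) \<in> reversal_matching k f" for a
    proof -
      obtain w where "a = f w" using e sub by blast
      then show ?thesis using e by (simp add: mem)
    qed
  qed
  ultimately show ?thesis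
    using inj sub by (simp add: reversal_tanglegram_def distinct_word_tree perfect_matching_def
        leaves_word_tree)
qed

lemma size_reversal: "inj f \<Longrightarrow> tanglegram_size (reversal_tanglegram k f) = 2 ^ k"
  using card_image[OF inj_on_subset[OF _ subset_UNIV], of f "{w. length w = k}"]
  by (simp add: reversal_tanglegram_def leaves_word_tree card_words)

lemma inj_reversal_edge: "inj f \<Longrightarrow> inj (reversal_edge f)"
  by (simp add: inj_def reversal_edge_def)

section \<open>Crossings in an arbitrary fixed layout\<close>

context
  fixes f :: "bool list \<Rightarrow> 'a" and k :: nat and l r :: "'a btree"
  assumes inj: "inj f"
    and l: "l \<in> orderings (word_tree k f)" and r: "r \<in> orderings (word_tree k f)"
begin

abbreviation crossing :: "bool list \<times> bool list \<Rightarrow> bool" where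
  "crossing p \<equiv> cross (l, r) (reversal_edge f (fst p)) (reversal_edge f (snd p))"

lemma above_flip:
  assumes "t \<in> orderings (word_tree k f)" "length x = k" "length y = k" "x \<noteq> y"
  shows "above t (f y) (f x) \<longleftrightarrow> \<not> above t (f x) (f y)"
proof -
  have "distinct (leaf_list t)"
    using assms(1) distinct_orderings distinct_word_tree inj by blast
  moreover have "f x \<in> leaves t" "f y \<in> leaves t"
    using assms(2,3) by (simp_all add: leaves_orderings[OF assms(1)] leaves_word_tree)
  moreover have "f x \<noteq> f y" using assms(4) inj by (simp add: inj_eq)
  ultimately show ?thesis using above_total above_asym by metis
qed

text \<open>Each side orders the leaves totally, so the two cases of a crossing collapse to a
  disagreement of two truth values.\<close>

lemma crossing_iff:
  assumes "length x = k" "length y = k" "x \<noteq> y"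
  shows "crossing (x, y) \<longleftrightarrow> above l (f x) (f y) \<noteq> above r (f (rev x)) (f (rev y))"
  using above_flip[OF l assms] above_flip[OF r, of "rev x" "rev y"] assms
  by (auto simp: reversal_edge_def)

text \<open>Refilling the blank keeps the first difference and hence the order in \<open>l\<close>.
  In \<open>r\<close> the reversed words branch at \<open>rev v\<close>, where the two words now
  exchange sides.\<close>

lemma crossing_frame_pair:
  assumes "q \<in> frames k"
  shows "crossing (frame_pair True q) \<longleftrightarrow> \<not> crossing (frame_pair False q)"
proof -
  obtain u a b v where q: "q = (u, a, b, v)" by (metis prod_cases4)
  have len: "length u + length a + length v + 2 = k" "length b = length a"
    using assms by (auto simp: q frames_def)
  define x where "x = (\<lambda>c. u @ False # a @ c # v)"
  define y where "y = (\<lambda>c. u @ True # b @ (\<not> c) # v)"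
  have xy: "length (x c) = k" "length (y c) = k" "x c \<noteq> y c" for c
    using len by (auto simp: x_def y_def)
  have L: "above l (f (x c)) (f (y c))" if "above l (f (x d)) (f (y d))" for c d
    using above_orderings_word_tree[OF inj l, of u "a @ d # v" "b @ (\<not> d) # v"
        "a @ c # v" "b @ (\<not> c) # v" False] that len
    by (simp add: x_def y_def)
  \<comment> \<open>After \<open>rev v\<close>, both \<open>x True\<close> and
    \<open>y False\<close> continue with \<open>True\<close>, and both \<open>y True\<close> and
    \<open>x False\<close> with \<open>False\<close>. The two instances give the two
    directions.\<close>
  have R: "above r (f (rev (x True))) (f (rev (y True))) \<longleftrightarrow>
      above r (f (rev (y False))) (f (rev (x False)))"
    using above_orderings_word_tree[OF inj r, of "rev v" "rev (u @ False # a)"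
        "rev (u @ True # b)" "rev (u @ True # b)" "rev (u @ False # a)" True]
      above_orderings_word_tree[OF inj r, of "rev v" "rev (u @ True # b)"
        "rev (u @ False # a)" "rev (u @ False # a)" "rev (u @ True # b)" True] len
    by (simp add: x_def y_def) blast
  have "above r (f (rev (y False))) (f (rev (x False))) \<longleftrightarrow>
      \<not> above r (f (rev (x False))) (f (rev (y False)))"
    using xy[of False] by (intro above_flip[OF r]) auto
  moreover have "frame_pair c q = (x c, y c)" for c by (simp add: q x_def y_def)
  ultimately show ?thesis
    using R L[of True False] L[of False True] crossing_iff[OF xy, of True] crossing_iff[OF xy, of False]
    by metis
qed

text \<open>Crossing is symmetric and irreflexive and an edge determines its word, so each unordered
  pair of crossing edges comes from exactly one member of \<open>word_pairs k\<close>.\<close>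

lemma layout_crossings_word_pairs:
  "layout_crossings (reversal_matching k f) (l, r) = card {p \<in> word_pairs k. crossing p}"
proof -
  let ?C = "{p \<in> word_pairs k. crossing p}" and ?e = "reversal_edge f"
  have irrefl: "\<not> cross (l, r) (?e x) (?e x)" for x
    using above_asym[OF distinct_orderings[OF l distinct_word_tree[OF inj]], of "f x" "f x"]
    by (auto simp: reversal_edge_def)
  have sym: "cross (l, r) (?e x) (?e y) \<Longrightarrow> cross (l, r) (?e y) (?e x)" for x y
    by (auto simp: reversal_edge_def)
  have "{{e, e'} | e e'. e \<in> reversal_matching k f \<and> e' \<in> reversal_matching k f \<and> cross (l, r) e e'}
      = (\<lambda>B. ?e ` B) ` (\<lambda>(x, y). {x, y}) ` ?C" (is "?A = ?B")
  proof (intro equalityI subsetI)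
    fix E assume "E \<in> ?A"
    then obtain x y where E: "E = {?e x, ?e y}" "length x = k" "length y = k"
      "cross (l, r) (?e x) (?e y)"
      by (auto simp: reversal_matching_def simp del: cross.simps)
    then have "x \<noteq> y" using irrefl by auto
    then have "(x, y) \<in> ?C \<or> (y, x) \<in> ?C" using E word_pairs_total[of x k y] sym by auto
    then have "{x, y} \<in> (\<lambda>(x, y). {x, y}) ` ?C" by (rule doubleton_in_image)
    then show "E \<in> ?B" by (rule rev_image_eqI) (simp add: E(1))
  next
    fix E assume "E \<in> ?B"
    then obtain p where p: "p \<in> ?C" "E = ?e ` (\<lambda>(x, y). {x, y}) p" by blast
    obtain x y where "p = (x, y)" by fastforce
    then have E: "E = {?e x, ?e y}" "(x, y) \<in> word_pairs k" "cross (l, r) (?e x) (?e y)"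
      using p by simp_all
    have "?e x \<in> reversal_matching k f" "?e y \<in> reversal_matching k f"
      using word_pairs_distinct[OF E(2)] by (simp_all add: reversal_matching_def)
    then show "E \<in> ?A" using E(1,3) by blast
  qed
  moreover have "card ?B = card ?C"
  proof -
    have "inj_on (\<lambda>(x, y). {x, y}) ?C"
      by (rule inj_on_subset[OF inj_on_unordered_word_pairs]) blast
    moreover have "inj_on (\<lambda>B. ?e ` B) A" for A
      by (rule inj_onI) (use inj_image_eq_iff[OF inj_reversal_edge[OF inj]] in blast)
    ultimately show ?thesis by (simp only: card_image)
  qed
  ultimately show ?thesis by (simp add: layout_crossings_def)
qed

text \<open>Exactly one filling of each frame crosses, so only the first summand depends on the
  layout.\<close>

lemma layout_crossings_split:
  "layout_crossings (reversal_matching k f) (l, r) =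
     card {p \<in> single_pairs k. crossing p} + card (frames k)"
proof -
  let ?F = "\<lambda>c. {p \<in> frame_pair c ` frames k. crossing p}"
  let ?Q = "\<lambda>c. {q \<in> frames k. crossing (frame_pair c q)}"
  have F: "card (?F c) = card (?Q c)" for c
  proof -
    have "?F c = frame_pair c ` ?Q c" by auto
    then show ?thesis by (simp add: card_image inj_frame_pair)
  qed
  \<comment> \<open>The frames are divided according to which of their fillings crosses.\<close>
  have "frames k = ?Q False \<union> ?Q True" "?Q False \<inter> ?Q True = {}"
    using crossing_frame_pair by blast+
  then have Q: "card (frames k) = card (?Q False) + card (?Q True)"
    by (metis (no_types, lifting) card_Un_disjoint finite_Un finite_frames)
  have "{p \<in> word_pairs k. crossing p} =
      {p \<in> single_pairs k. crossing p} \<union> (?F False \<union> ?F True)"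
    unfolding word_pairs_split by blast
  moreover have "card \<dots> = card {p \<in> single_pairs k. crossing p} + (card (?F False) + card (?F True))"
  proof -
    have "finite {p \<in> single_pairs k. crossing p}"
      using finite_word_pairs[of k] by (simp add: word_pairs_split)
    moreover have "finite (?F c)" for c by (simp add: finite_frames)
    moreover have "?F False \<inter> ?F True = {}" using frame_pair_disjoint[of k] by blast
    moreover have "{p \<in> single_pairs k. crossing p} \<inter> (?F False \<union> ?F True) = {}"
      using single_pairs_disjoint[of k] by blast
    ultimately show ?thesis by (simp only: card_Un_disjoint finite_Un simp_thms)
  qed
  ultimately show ?thesis unfolding layout_crossings_word_pairs by (simp only: F Q)
qed

end

text \<open>The number of frames is a lower bound for every layout, and the alphabetical layout on
  both sides removes the remaining summand.\<close>

lemma crt_reversal: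
  assumes "inj f"
  shows "crt (reversal_tanglegram k f) = card (frames k)"
proof -
  let ?t = "word_tree k f"
  have no_single: "\<not> cross (?t, ?t) (reversal_edge f x) (reversal_edge f y)"
    if "(x, y) \<in> single_pairs k" for x y
  proof -
    obtain u a where xy: "x = u @ False # a" "y = u @ True # a" "length u + length a + 1 = k"
      using \<open>(x, y) \<in> single_pairs k\<close> by (auto simp: single_pairs_def)
    \<comment> \<open>Reversal exchanges prefix and suffix around the single differing letter, so
      \<open>x\<close> precedes \<open>y\<close> on both sides.\<close>
    have "above ?t (f x) (f y)" "above ?t (f (rev x)) (f (rev y))"
      using above_word_tree[of u a k a f] above_word_tree[of "rev a" "rev u" k "rev u" f] xy by auto
    then show ?thesis
      using above_asym[OF distinct_word_tree[OF assms]] by (auto simp: reversal_edge_def)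
  qed
  have "Min (layout_crossings (reversal_matching k f) ` (orderings ?t \<times> orderings ?t)) = card (frames k)"
  proof (rule Min_eqI)
    show "finite (layout_crossings (reversal_matching k f) ` (orderings ?t \<times> orderings ?t))"
      by (simp add: finite_orderings)
  next
    fix n assume "n \<in> layout_crossings (reversal_matching k f) ` (orderings ?t \<times> orderings ?t)"
    then show "card (frames k) \<le> n"
      using layout_crossings_split[OF assms, of _ k] by auto
  next
    have "{p \<in> single_pairs k. cross (?t, ?t) (reversal_edge f (fst p)) (reversal_edge f (snd p))} = {}"
      using no_single by fastforce
    then have "card (frames k) = layout_crossings (reversal_matching k f) (?t, ?t)"
      using layout_crossings_split[OF assms self_in_orderings self_in_orderings, of k]
      by (simp only: card.empty add_0)
    then show "card (frames k) \<in> layout_crossings (reversal_matching k f) ` (orderings ?t \<times> orderings ?t)"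
      using self_in_orderings by blast
  qed
  then show ?thesis by (simp add: reversal_tanglegram_def)
qed

theorem theorem1:
  fixes i :: nat
  assumes "i \<ge> 1"
  shows "\<exists>T :: (nat, nat) tangle. tanglegram T \<and> tanglegram_size T = 2 ^ i \<and>
    real (crt T) = 1 / 2 * real (2 ^ i choose 2) - real i * 2 powi (int i - 2)"
proof (intro exI conjI)
  \<comment> \<open>The injection \<open>to_nat\<close> turns words into the required numerical leaf
    names.\<close>
  let ?T = "reversal_tanglegram i (to_nat :: bool list \<Rightarrow> nat)"
  have inj: "inj (to_nat :: bool list \<Rightarrow> nat)" by simp
  show "tanglegram ?T" "tanglegram_size ?T = 2 ^ i"
    using tanglegram_reversal[OF inj] size_reversal[OF inj] by auto
  have "2 ^ i choose 2 = i * 2 ^ (i - 1) + 2 * crt ?T"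
    using card_word_pairs[of i] card_word_pairs_split[of i] card_single_pairs[of i] crt_reversal[OF inj, of i]
    by simp
  then have "real (2 ^ i choose 2) = real i * 2 ^ (i - 1) + 2 * real (crt ?T)"
    by simp
  \<comment> \<open>Since \<open>i\<close> is at least 1, the natural number \<open>i - 1\<close> is
    the true difference, whereas \<open>i - 2\<close> is negative for \<open>i = 1\<close> and needs
    the integer exponent.\<close>
  moreover have "(2 :: real) ^ (i - 1) = 2 * 2 powi (int i - 2)"
    using assms by (cases i) (auto simp: power_int_diff field_simps)
  ultimately show "real (crt ?T) = 1 / 2 * real (2 ^ i choose 2) - real i * 2 powi (int i - 2)"
    by (simp add: field_simps)
qed

end
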